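(* There exists a natural number $m$ such that for every natural number $n$ there is a colouring of $\mathbb{E}^n$ with the two colours red and blue which contains no red (isometric) copy of $\ell_3$ and no blue (isometric) copy of $\ell_m$. That is, $\mathbb{E}^n \nrightarrow (\ell_3, \ell_m)$ for all $n$.
   Context: $\mathbb{E}^n$ denotes $\mathbb{R}^n$ with the Euclidean metric. For a natural number $k$, $\ell_k$ denotes a set of $k$ points on a line with consecutive points at distance one (e.g. $\{0,1,\dots,k-1\}\subset\mathbb{R}$). A copy of a set $X$ means an isometric copy, i.e. the image of $X$ under a distance-preserving map into $\mathbb{E}^n$; a copy is red (resp. blue) if all its points are coloured red (resp. blue). The notation $\mathbb{E}^n \nrightarrow (X_1,X_2)$ means there is a red/blue-colouring of $\mathbb{E}^n$ with no red copy of $X_1$ and no blue copy of $X_2$. *)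

theory Defs
  imports "HOL-Analysis.Analysis"
begin

text \<open>
  The dimension is quantified inside the statement, after the existential quantifier on \<open>m\<close>,
  so it cannot be the index of a type.  As in \<^const>\<open>Euclidean_space\<close>, a point of n-dimensional
  space is a sequence of reals that vanishes from index \<open>n\<close> on.
\<close>

definition E_dist :: "nat \<Rightarrow> (nat \<Rightarrow> real) \<Rightarrow> (nat \<Rightarrow> real) \<Rightarrow> real" where
  "E_dist n x y = L2_set (\<lambda>i. x i - y i) {..<n}"

definition E :: "nat \<Rightarrow> (nat \<Rightarrow> real) metric" where
  "E n = metric (topspace (Euclidean_space n), E_dist n)"

text \<open>The type constructor \<^type>\<open>metric\<close> only gives access to \<open>E_dist\<close> once it is known to be a metric.\<close>

lemma Metric_space_E: "Metric_space (topspace (Euclidean_space n)) (E_dist n)"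
proof
  fix x y z :: "nat \<Rightarrow> real"
  show "0 \<le> E_dist n x y"
    by (simp add: E_dist_def)
  show "E_dist n x y = E_dist n y x"
    by (simp add: E_dist_def L2_set_def power2_commute)
  show "E_dist n x y = 0 \<longleftrightarrow> x = y"
    if "x \<in> topspace (Euclidean_space n)" "y \<in> topspace (Euclidean_space n)"
  proof
    assume 0: "E_dist n x y = 0"
    show "x = y"
    proof
      show "x i = y i" for i
        using 0 that
        by (cases "i < n") (simp_all add: E_dist_def L2_set_eq_0_iff topspace_Euclidean_space)
    qed
  next
    assume "x = y"
    then show "E_dist n x y = 0"
      by (simp add: E_dist_def L2_set_0')
  qed
  show "E_dist n x z \<le> E_dist n x y + E_dist n y z"
    using L2_set_triangle_ineq [of "\<lambda>i. x i - y i" "\<lambda>i. y i - z i" "{..<n}"]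
    by (simp add: E_dist_def)
qed

lemma mspace_E: "mspace (E n) = {x. \<forall>i\<ge>n. x i = 0}"
  unfolding E_def Metric_space.mspace_metric [OF Metric_space_E] by (rule topspace_Euclidean_space)

lemma mdist_E: "mdist (E n) x y = sqrt (\<Sum>i<n. (x i - y i)\<^sup>2)"
  unfolding E_def Metric_space.mdist_metric [OF Metric_space_E] E_dist_def L2_set_def ..

definition ell :: "nat \<Rightarrow> real set" where
  "ell k = real ` {..<k}"

definition isometric_copy :: "'b metric \<Rightarrow> 'a::metric_space set \<Rightarrow> 'b set \<Rightarrow> bool" where
  "isometric_copy M X C \<longleftrightarrow>
     (\<exists>f. f \<in> X \<rightarrow> mspace M \<and> (\<forall>x\<in>X. \<forall>y\<in>X. mdist M (f x) (f y) = dist x y) \<and> C = f ` X)"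

datatype colour = Red | Blue

text \<open>Only the colours of points of \<^term>\<open>mspace M\<close> matter below, as copies are subsets of it.\<close>

definition not_arrows ::
  "'c metric \<Rightarrow> 'a::metric_space set \<Rightarrow> 'b::metric_space set \<Rightarrow> bool" where
  "not_arrows M X\<^sub>1 X\<^sub>2 \<longleftrightarrow>
     (\<exists>c :: 'c \<Rightarrow> colour.
        (\<nexists>C. isometric_copy M X\<^sub>1 C \<and> (\<forall>p\<in>C. c p = Red)) \<and>
        (\<nexists>C. isometric_copy M X\<^sub>2 C \<and> (\<forall>p\<in>C. c p = Blue)))"

end

(* Colour a point x red iff the fractional part of (20/81) |x|^2 is below 2/9.
   If x, y, z are consecutive points at unit distance on a line, then |x|^2 - 2 |y|^2 + |z|^2 = 2.
   For red x, y, z the same combination of the fractional parts lies in (-4/9, 4/9), yet it is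
   congruent to 40/81 modulo 1, which is impossible.
   Along unit-spaced points on a line (20/81) |x|^2 is a quadratic sequence with leading
   coefficient 20/81.  Restricted to an arithmetic progression of step 9 it is linear modulo 1,
   since 20/81 * 9^2 is an integer, and since 40 is invertible modulo 9 the start of the
   progression can be chosen so that the slope lies in [1/9, 2/9) modulo 1.  Such a sequence cannot
   jump over the red interval [0, 2/9), so it meets red within 9 steps. *)

theory Submission
  imports Defs
begin

lemma frac_eq_frac_diff_int:
  fixes x y :: real
  assumes "x - y \<in> \<int>"
  shows "frac x = frac y"
  using assms by (metis Ints_cases add.commute diff_add_cancel frac_add_of_int_right)

text \<open>Distances 1, 1, 2 force \<open>y\<close> to be the midpoint of \<open>x\<close> and
  \<open>z\<close>: by the parallelogram law the squared norm of \<open>x - 2 * y + z\<close> is 2 +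
  2 - 4 = 0. With \<open>y\<close> eliminated, the combination is half the squared distance of
  \<open>x\<close> and \<open>z\<close>.\<close>

lemma sum_squares_unit_triple:
  fixes x y z :: "'i \<Rightarrow> real"
  assumes "finite A"
    and xy: "(\<Sum>i\<in>A. (x i - y i)\<^sup>2) = 1"
    and yz: "(\<Sum>i\<in>A. (y i - z i)\<^sup>2) = 1"
    and xz: "(\<Sum>i\<in>A. (x i - z i)\<^sup>2) = 4"
  shows "(\<Sum>i\<in>A. (x i)\<^sup>2) - 2 * (\<Sum>i\<in>A. (y i)\<^sup>2) + (\<Sum>i\<in>A. (z i)\<^sup>2) = 2"
proof -
  have "(\<Sum>i\<in>A. (x i - 2 * y i + z i)\<^sup>2)
      = (\<Sum>i\<in>A. 2 * (x i - y i)\<^sup>2 + 2 * (y i - z i)\<^sup>2 - (x i - z i)\<^sup>2)"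
    by (intro sum.cong refl) (simp add: power2_eq_square algebra_simps)
  also have "\<dots> = 0"
    by (simp add: sum_subtractf sum.distrib flip: sum_distrib_left) (simp add: xy yz xz)
  finally have mid: "x i - 2 * y i + z i = 0" if "i \<in> A" for i
    using that \<open>finite A\<close> by (subst (asm) sum_nonneg_eq_0_iff) auto
  have "(\<Sum>i\<in>A. (x i)\<^sup>2) - 2 * (\<Sum>i\<in>A. (y i)\<^sup>2) + (\<Sum>i\<in>A. (z i)\<^sup>2)
      = (\<Sum>i\<in>A. (x i)\<^sup>2 - 2 * (y i)\<^sup>2 + (z i)\<^sup>2)"
    by (simp add: sum_subtractf sum.distrib sum_distrib_left)
  also have "\<dots> = (\<Sum>i\<in>A. (x i - z i)\<^sup>2 / 2)"
  proof (intro sum.cong refl)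
    fix i assume "i \<in> A"
    then have y: "y i = (x i + z i) / 2"
      using mid by fastforce
    show "(x i)\<^sup>2 - 2 * (y i)\<^sup>2 + (z i)\<^sup>2 = (x i - z i)\<^sup>2 / 2"
      unfolding y by (simp add: power2_eq_square field_simps)
  qed
  also have "\<dots> = 2"
    by (simp add: xz flip: sum_divide_distrib)
  finally show ?thesis .
qed

text \<open>The second difference 2 forces leading coefficient 1; the linear coefficient is then
  fitted to \<open>t 1 - t 0\<close>.\<close>

lemma second_difference_2_imp_quadratic:
  fixes t :: "nat \<Rightarrow> real"
  assumes "\<And>i. i + 2 < m \<Longrightarrow> t i - 2 * t (i + 1) + t (i + 2) = 2" and "i < m"
  shows "t i = t 0 + (t 1 - t 0 - 1) * real i + (real i)\<^sup>2"
  using \<open>i < m\<close>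
proof (induction i rule: less_induct)
  case (less i)
  consider "i = 0" | "i = 1" | k where "i = k + 2"
    by (metis One_nat_def add_2_eq_Suc' not0_implies_Suc)
  then show ?case
  proof cases
    case 3
    then have "t i = 2 + 2 * t (k + 1) - t k"
      using assms(1)[of k] less.prems by simp
    with 3 less.IH[of k] less.IH[of "k + 1"] less.prems show ?thesis
      by (simp add: power2_eq_square algebra_simps)
  qed simp_all
qed

lemma no_red_triple:
  fixes x y z :: real
  assumes "x - 2 * y + z = 2"
    and "frac (20/81 * x) < 2/9" "frac (20/81 * y) < 2/9" "frac (20/81 * z) < 2/9"
  shows False
proof -
  define k where "k = \<lfloor>20/81 * x\<rfloor> - 2 * \<lfloor>20/81 * y\<rfloor> + \<lfloor>20/81 * z\<rfloor>"
  have eq: "frac (20/81 * x) - 2 * frac (20/81 * y) + frac (20/81 * z) = 40/81 - real_of_int k"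
    using assms(1) by (simp add: frac_def k_def field_simps)
  have "0 \<le> frac (20/81 * x)" "0 \<le> frac (20/81 * y)" "0 \<le> frac (20/81 * z)"
    by simp_all
  \<comment> \<open>The left side of \<open>eq\<close> lies strictly between -36/81 and 36/81, so
    \<open>k\<close> lies strictly between 4/81 and 76/81.\<close>
  with eq assms(2-4) have "real_of_int k < 1" "real_of_int k > 0"
    by linarith+
  then show False
    by simp
qed

lemma small_steps_hit:
  fixes \<eta> \<phi> :: real
  assumes "1/9 \<le> \<eta>" "\<eta> < 2/9"
  shows "\<exists>j::nat. j \<le> 8 \<and> frac (\<phi> + real j * \<eta>) < 2/9"
proof (cases "frac \<phi> < 2/9")
  case True
  then show ?thesis
    by (intro exI[of _ 0]) simp
next
  case False
  \<comment> \<open>\<open>r\<close> counts, as a real number, the steps from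
    \<open>frac \<phi>\<close> up to 1. Rounding up overshoots 1 by less than one step, hence by
    less than 2/9. Outside red the gap is at most 7/9, that is, 7 steps of the least size
    1/9.\<close>
  define r where "r = (1 - frac \<phi>) / \<eta>"
  define j where "j = nat \<lceil>r\<rceil>"
  have "\<eta> > 0" "frac \<phi> < 1"
    using assms by (simp_all add: frac_lt_1)
  then have "r > 0"
    by (simp add: r_def)
  then have j: "r \<le> real j" "real j < r + 1"
    unfolding j_def by linarith+
  have r\<eta>: "r * \<eta> = 1 - frac \<phi>"
    using \<open>\<eta> > 0\<close> by (simp add: r_def)
  have "r \<le> 7"
    using False assms \<open>\<eta> > 0\<close> by (simp add: r_def field_simps)
  with j have "j \<le> 8"
    by linarith
  have "r * \<eta> \<le> real j * \<eta>" "real j * \<eta> < (r + 1) * \<eta>"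
    using j \<open>\<eta> > 0\<close> by simp_all
  with r\<eta> have "0 \<le> frac \<phi> + real j * \<eta> - 1" "frac \<phi> + real j * \<eta> - 1 < \<eta>"
    by (simp_all add: algebra_simps)
  moreover have "frac (\<phi> + real j * \<eta>) = frac (frac \<phi> + real j * \<eta> - 1)"
    by (rule frac_eq_frac_diff_int) (simp add: frac_def)
  ultimately have "frac (\<phi> + real j * \<eta>) < 2/9"
    using assms frac_eq[of "frac \<phi> + real j * \<eta> - 1"] by simp
  with \<open>j \<le> 8\<close> show ?thesis
    by blast
qed

lemma quadratic_hits:
  fixes \<beta> \<gamma> :: real
  shows "\<exists>i::nat. i < 81 \<and> frac (20/81 * (real i)\<^sup>2 + \<beta> * real i + \<gamma>) < 2/9"
proof -
  \<comment> \<open>Along \<open>a + 9 * j\<close> the slope in \<open>j\<close> is (40 a + 81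
    \<beta>)/9, so making \<open>40 * a + v\<close> congruent to 1 modulo 9 puts it in [1/9, 2/9)
    modulo 1.\<close>
  define v where "v = \<lfloor>81 * \<beta>\<rfloor>"
  \<comment> \<open>7 inverts 40 modulo 9\<close>
  define a where "a = nat (7 * (1 - v) mod 9)"
  have "a \<le> 8"
    unfolding a_def by linarith
  have "(40 * int a + v) mod 9 = (40 * (7 * (1 - v)) + v) mod 9"
    by (simp only: a_def nat_0_le pos_mod_sign zero_less_numeral)
       (metis mod_add_left_eq mod_mult_right_eq)
  \<comment> \<open>40 * 7 = 280 = 9 * 31 + 1.\<close>
  also have "\<dots> = (1 + 9 * (31 - 31 * v)) mod 9"
    by (simp add: algebra_simps)
  also have "\<dots> = 1"
    by (simp only: mod_mult_self2) simp
  finally have "(40 * int a + v) mod 9 = 1" .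
  then obtain k where "40 * int a + v = 9 * k + 1"
    by (metis mult_div_mod_eq)
  then have k: "40 * real a + real_of_int v = 9 * real_of_int k + 1"
    by (metis (mono_tags) of_int_1 of_int_add of_int_mult of_int_numeral of_int_of_nat_eq)
  define \<eta> where "\<eta> = 9 * \<beta> + 40 * real a / 9 - real_of_int k"
  define \<phi> where "\<phi> = 20/81 * (real a)\<^sup>2 + \<beta> * real a + \<gamma>"
  have "real_of_int v \<le> 81 * \<beta>" "81 * \<beta> < real_of_int v + 1"
    unfolding v_def by linarith+
  with k have "1/9 \<le> \<eta>" "\<eta> < 2/9"
    unfolding \<eta>_def by (simp_all add: field_simps)
  then obtain j :: nat where j: "j \<le> 8" "frac (\<phi> + real j * \<eta>) < 2/9"
    using small_steps_hit by blast
  let ?i = "a + 9 * j"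
  \<comment> \<open>Expanding leaves 20 j^2, integral because 20/81 * 9^2 = 20, and
    \<open>j * k\<close>, from the integer subtracted in \<open>\<eta>\<close>.\<close>
  have "20/81 * (real ?i)\<^sup>2 + \<beta> * real ?i + \<gamma> - (\<phi> + real j * \<eta>)
      = of_int (20 * int j * int j + int j * k)"
    by (simp add: \<phi>_def \<eta>_def power2_eq_square field_simps)
  then have "frac (20/81 * (real ?i)\<^sup>2 + \<beta> * real ?i + \<gamma>) = frac (\<phi> + real j * \<eta>)"
    by (intro frac_eq_frac_diff_int) (metis Ints_of_int)
  \<comment> \<open>The largest index is 8 + 9 * 8 = 80, whence the value 81 for
    \<open>m\<close>.\<close>
  moreover have "?i < 81"
    using j \<open>a \<le> 8\<close> by simp
  ultimately show ?thesis
    using j by metis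
qed

lemma isometric_copy_ell_second_difference:
  assumes dist: "\<forall>x\<in>ell m. \<forall>y\<in>ell m. mdist (E n) (f x) (f y) = dist x y" and "i + 2 < m"
  shows "(\<Sum>l<n. (f (real i) l)\<^sup>2) - 2 * (\<Sum>l<n. (f (real (i + 1)) l)\<^sup>2)
    + (\<Sum>l<n. (f (real (i + 2)) l)\<^sup>2) = 2"
proof -
  have "(\<Sum>l<n. (f (real j) l - f (real k) l)\<^sup>2) = (real j - real k)\<^sup>2" if "j < m" "k < m" for j k
  proof -
    have "real j \<in> ell m" "real k \<in> ell m"
      using that by (simp_all add: ell_def)
    then have "sqrt (\<Sum>l<n. (f (real j) l - f (real k) l)\<^sup>2) = \<bar>real j - real k\<bar>"
      using dist by (simp only: mdist_E dist_real_def)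
    then show ?thesis
      by (simp flip: real_sqrt_abs)
  qed
  from this[of i "i + 1"] this[of "i + 1" "i + 2"] this[of i "i + 2"] \<open>i + 2 < m\<close>
  show ?thesis
    by (intro sum_squares_unit_triple) simp_all
qed

theorem theorem1p1:
  shows "\<exists>m::nat. \<forall>n::nat. not_arrows (E n) (ell 3) (ell m)"
proof (intro exI[of _ 81] allI)
  fix n :: nat
  define q :: "(nat \<Rightarrow> real) \<Rightarrow> real" where "q p = (\<Sum>l<n. (p l)\<^sup>2)" for p
  define c where "c p = (if frac (20/81 * q p) < 2/9 then Red else Blue)" for p
  have diff: "q (f (real i)) - 2 * q (f (real (i + 1))) + q (f (real (i + 2))) = 2"
    if "\<forall>x\<in>ell m. \<forall>y\<in>ell m. mdist (E n) (f x) (f y) = dist x y" "i + 2 < m" for f m i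
    using isometric_copy_ell_second_difference[OF that] by (simp add: q_def)
  have "\<exists>p\<in>C. c p \<noteq> Red" if copy: "isometric_copy (E n) (ell 3) C" for C
  proof (rule ccontr)
    assume "\<not> ?thesis"
    with copy obtain f where
      f: "\<forall>x\<in>ell 3. \<forall>y\<in>ell 3. mdist (E n) (f x) (f y) = dist x y" "\<forall>x\<in>ell 3. c (f x) = Red"
      by (auto simp: isometric_copy_def)
    have "frac (20/81 * q (f (real i))) < 2/9" if "i < 3" for i
      using f(2) that by (auto simp: ell_def c_def split: if_splits)
    from no_red_triple[OF diff[OF f(1), of 0] this this this] show False
      by simp
  qed
  moreover have "\<exists>p\<in>C. c p \<noteq> Blue" if copy: "isometric_copy (E n) (ell 81) C" for C
  proof -
    from copy obtain f where
      f: "\<forall>x\<in>ell 81. \<forall>y\<in>ell 81. mdist (E n) (f x) (f y) = dist x y" "C = f ` ell 81"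
      by (auto simp: isometric_copy_def)
    \<comment> \<open>The position of the copy enters only through \<open>t 0\<close> and
      \<open>t 1\<close>, which determine the coefficients \<beta> and \<gamma> of
      \<open>quadratic_hits\<close>. That lemma is uniform in both, so 81 serves every
      \<open>n\<close>.\<close>
    define t where "t i = q (f (real i))" for i
    obtain i :: nat where i: "i < 81"
      "frac (20/81 * (real i)\<^sup>2 + 20/81 * (t 1 - t 0 - 1) * real i + 20/81 * t 0) < 2/9"
      using quadratic_hits by blast
    have "t i = t 0 + (t 1 - t 0 - 1) * real i + (real i)\<^sup>2"
      by (rule second_difference_2_imp_quadratic[of 81]) (use diff[OF f(1)] i in \<open>auto simp: t_def\<close>)
    then have "20/81 * t i
        = 20/81 * (real i)\<^sup>2 + 20/81 * (t 1 - t 0 - 1) * real i + 20/81 * t 0"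
      by (simp add: field_simps)
    with i(2) have "c (f (real i)) = Red"
      unfolding c_def t_def by presburger
    then show ?thesis
      using i(1) f(2) by (intro bexI[of _ "f (real i)"]) (auto simp: ell_def)
  qed
  ultimately show "not_arrows (E n) (ell 3) (ell 81)"
    unfolding not_arrows_def by blast
qed

end
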